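(* Let $\mathcal X$ be a separable infinite-dimensional (real or complex) Banach space, let $T: D(T)\subseteq\mathcal X\to\mathcal X$ be a linear operator, and let $Y$ be a linear subspace of $Y_0=\bigcap_{n=1}^\infty D(T^n)$. If $(T,Y)$ is relatively hypercyclic, then $(T,Y)$ is topologically transitive.
   Context: $T$ is linear on a linear subspace $D(T)$ of $\mathcal X$ (bounded or unbounded). Powers are defined on their natural domains: $D(T^{n+1})=\{x\in D(T^n): T^nx\in D(T)\}$, and $T^0=I$. For $x\in Y_0$, $\mathrm{orb}(x,T)=\{x,Tx,T^2x,\dots\}$. Closures $\overline{M}$ are taken in $\mathcal X$; "open in $Y$" means open in the relative norm topology of $Y$. $(T,Y)$ is relatively hypercyclic if there is a nonzero vector $x\in Y_0$ with $\overline{\mathrm{orb}(x,T)\cap Y}\supseteq Y$. $(T,Y)$ is topologically transitive if for any pair of nonempty open sets $U,V$ in $Y$ there is a non-negative integer $n$ with $T^n(U)\cap V\ne\emptyset$. *)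

theory Defs
  imports "HOL-Analysis.Analysis"
begin

(* The library has no type class of complex normed spaces, so the scalar field is a type 'k of
   class real_normed_field with an explicit scalar multiplication. By the Gelfand-Mazur theorem
   every such field is isometrically isomorphic to the reals or to the complex numbers, so this
   covers exactly real and complex normed spaces. The second axiom ties the scalar multiplication
   to the real structure that the class real_normed_vector provides; completeness is expressed by
   taking 'x of class banach. *)
locale normed_space_over = vector_space smul
  for smul :: "'k::real_normed_field \<Rightarrow> 'x::real_normed_vector \<Rightarrow> 'x" +
  assumes norm_smul: "norm (smul c x) = norm c * norm x"
    and smul_of_real: "smul (of_real r) x = r *\<^sub>R x"

definition infinite_dimensional :: "('k::field \<Rightarrow> 'x::ab_group_add \<Rightarrow> 'x) \<Rightarrow> bool" where
  "infinite_dimensional smul \<longleftrightarrow> \<not> (\<exists>B. finite B \<and> module.span smul B = UNIV)"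

(* A partially defined operator is a pair of a domain D and a total function T, whose values
   outside D are irrelevant. *)
definition linear_operator ::
    "('k::field \<Rightarrow> 'x::ab_group_add \<Rightarrow> 'x) \<Rightarrow> 'x set \<Rightarrow> ('x \<Rightarrow> 'x) \<Rightarrow> bool" where
  "linear_operator smul D T \<longleftrightarrow>
     module.subspace smul D \<and>
     (\<forall>x\<in>D. \<forall>y\<in>D. T (x + y) = T x + T y) \<and>
     (\<forall>c. \<forall>x\<in>D. T (smul c x) = smul c (T x))"

(* The iterate T ^^ n represents the n-th power of the operator only on pow_domain D T n, where
   all intermediate iterates lie in D. *)
primrec pow_domain :: "'x set \<Rightarrow> ('x \<Rightarrow> 'x) \<Rightarrow> nat \<Rightarrow> 'x set" where
  "pow_domain D T 0 = UNIV"
| "pow_domain D T (Suc n) = {x \<in> pow_domain D T n. (T ^^ n) x \<in> D}"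

definition common_domain :: "'x set \<Rightarrow> ('x \<Rightarrow> 'x) \<Rightarrow> 'x set" where
  "common_domain D T = (\<Inter>n\<in>{1..}. pow_domain D T n)"

definition orb :: "'x \<Rightarrow> ('x \<Rightarrow> 'x) \<Rightarrow> 'x set" where
  "orb x T = {(T ^^ n) x |n. True}"

definition relatively_hypercyclic ::
    "'x::real_normed_vector set \<Rightarrow> ('x \<Rightarrow> 'x) \<Rightarrow> 'x set \<Rightarrow> bool" where
  "relatively_hypercyclic D T Y \<longleftrightarrow>
     (\<exists>x\<in>common_domain D T. x \<noteq> 0 \<and> closure (orb x T \<inter> Y) \<supseteq> Y)"

(* Meant for Y contained in common_domain D T, so that every power of T is defined on U;
   for this reason D does not occur as a parameter. *)
definition topologically_transitive ::
    "('x::real_normed_vector \<Rightarrow> 'x) \<Rightarrow> 'x set \<Rightarrow> bool" where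
  "topologically_transitive T Y \<longleftrightarrow>
     (\<forall>U V. openin (top_of_set Y) U \<and> U \<noteq> {} \<and> openin (top_of_set Y) V \<and> V \<noteq> {} \<longrightarrow>
        (\<exists>n. (T ^^ n) ` U \<inter> V \<noteq> {}))"

end

theory Submission
  imports Defs
begin

text \<open>A connected set with more than one point has no isolated points, so an orbit that is dense
  in it enters every nonempty relatively open set infinitely often. If the orbit point
  \<open>(T ^^ k) x\<close> lies in \<open>U\<close>, then some later orbit point \<open>(T ^^ m) x\<close> with \<open>m \<ge> k\<close> lies in \<open>V\<close>,
  and \<open>T ^^ (m - k)\<close> maps the former to the latter.\<close>

text \<open>Real scalars act through \<open>of_real\<close>, so closure under \<open>smul\<close>
  includes closure under real scaling. This makes real convexity available for
  \<open>Y\<close>.\<close>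

lemma normed_space_over_subspace_imp_subspace:
  assumes "normed_space_over smul" "module.subspace smul Y"
  shows "subspace Y"
proof -
  interpret normed_space_over smul by (fact assms(1))
  show ?thesis
    using subspace_0[OF assms(2)] subspace_add[OF assms(2)] subspace_scale[OF assms(2), of _ "of_real _"]
    by (auto simp: smul_of_real intro!: real_vector.subspaceI)
qed

text \<open>Finite sets are closed in a T1 space, so a finite \<open>V\<close> would be clopen and
  hence all of the infinite set \<open>Y\<close>.\<close>

lemma infinite_openin_connected:
  fixes Y :: "'a::t1_space set"
  assumes "connected Y" "infinite Y" "openin (top_of_set Y) V" "V \<noteq> {}"
  shows "infinite V"
proof
  assume "finite V"
  then have "closedin (top_of_set Y) V"
    using assms(3) by (simp add: closed_subset finite_imp_closed openin_imp_subset)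
  then show False
    using assms \<open>finite V\<close> connected_clopen[of Y] by blast
qed

lemma topologically_transitive_if_dense_orb:
  assumes "connected Y" "Y \<subseteq> closure (orb x T \<inter> Y)"
  shows "topologically_transitive T Y"
  unfolding topologically_transitive_def
proof (intro allI impI, elim conjE)
  fix U V
  assume U: "openin (top_of_set Y) U" "U \<noteq> {}" and V: "openin (top_of_set Y) V" "V \<noteq> {}"
  have visit: "\<exists>n. (T ^^ n) x \<in> W" if W: "openin (top_of_set Y) W" "W \<noteq> {}" for W
  proof -
    obtain S where S: "open S" "W = Y \<inter> S"
      using W(1) by (auto simp: openin_open)
    then have "S \<inter> closure (orb x T \<inter> Y) \<noteq> {}"
      using W(2) assms(2) by blast
    then have "S \<inter> (orb x T \<inter> Y) \<noteq> {}"
      using open_Int_closure_eq_empty[OF S(1)] by blast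
    then show ?thesis
      using S(2) by (auto simp: orb_def)
  qed
  show "\<exists>n. (T ^^ n) ` U \<inter> V \<noteq> {}"
  proof (cases "finite Y")
    case True
    \<comment> \<open>Here \<open>U\<close> and \<open>V\<close> are the same single point, so the
      zeroth power suffices; deleting orbit points could leave \<open>V\<close> empty.\<close>
    then obtain y where "Y \<subseteq> {y}"
      using assms(1) connected_finite_iff_sing by blast
    then have "U \<inter> V \<noteq> {}"
      using U(2) V(2) openin_imp_subset[OF U(1)] openin_imp_subset[OF V(1)] by blast
    then have "(T ^^ 0) ` U \<inter> V \<noteq> {}"
      by simp
    then show ?thesis ..
  next
    case False
    obtain k where k: "(T ^^ k) x \<in> U"
      using visit[OF U] ..
    \<comment> \<open>\<open>F\<close> holds the orbit points before time \<open>k\<close>; a visit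
      to \<open>V - F\<close> therefore cannot happen earlier than \<open>k\<close>.\<close>
    define F where "F = (\<lambda>i. (T ^^ i) x) ` {..<k}"
    have "finite F"
      by (simp add: F_def)
    then have "V - F \<noteq> {}"
      using infinite_openin_connected[OF assms(1) False V] by (metis Diff_eq_empty_iff finite_subset)
    moreover have "openin (top_of_set Y) (V - F)"
      using openin_Int_open[OF V(1) open_Compl[OF finite_imp_closed[OF \<open>finite F\<close>]]]
      by (simp add: Diff_eq)
    ultimately obtain m where m: "(T ^^ m) x \<in> V - F"
      using visit by metis
    then have "k \<le> m"
      by (metis DiffD2 F_def imageI lessThan_iff not_le)
    then have "(T ^^ (m - k)) ((T ^^ k) x) = (T ^^ m) x"
      by (metis comp_apply funpow_add le_add_diff_inverse2)
    then show ?thesis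
      using k m by (metis DiffD1 disjoint_iff imageI)
  qed
qed

theorem proposition2p7:
  fixes smul :: "'k::real_normed_field \<Rightarrow> 'x::banach \<Rightarrow> 'x"
    and D Y :: "'x set" and T :: "'x \<Rightarrow> 'x"
  assumes "normed_space_over smul"
    and "separable_space (euclidean :: 'x topology)"
    and "infinite_dimensional smul"
    and "linear_operator smul D T"
    and "module.subspace smul Y"
    and "Y \<subseteq> common_domain D T"
    and "relatively_hypercyclic D T Y"
  shows "topologically_transitive T Y"
proof -
  \<comment> \<open>A real subspace is convex, hence connected.\<close>
  have "connected Y"
    using normed_space_over_subspace_imp_subspace[OF assms(1,5)]
    by (simp add: convex_connected subspace_imp_convex)
  then show ?thesis
    using assms(7) topologically_transitive_if_dense_orb unfolding relatively_hypercyclic_def by blast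
qed

end
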